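(* Let $\mathbf{B}\in\mathbb{R}^{n\times n}$ and $\mathbf{R}\in\mathbb{R}^{d\times d}$ be symmetric positive definite matrices, let $\mathbf{x}_b\in\mathbb{R}^n$, $\mathbf{y}\in\mathbb{R}^d$, and let $h:\mathbb{R}^n\to\mathbb{R}^d$ be a map. Let $$J(\mathbf{x})=\tfrac12(\mathbf{x}-\mathbf{x}_b)^T\mathbf{B}^{-1}(\mathbf{x}-\mathbf{x}_b)+\tfrac12(\mathbf{y}-h[\mathbf{x}])^T\mathbf{R}^{-1}(\mathbf{y}-h[\mathbf{x}]),\qquad \mathbf{x}\in\mathbb{R}^n.$$ Let $1\le\kappa_{max}<\kappa(\mathbf{R})$, let $T=\lambda_1/\kappa_{max}$, let $\mathbf{R}_{ME}=\mathbf{V}_{\mathbf{R}}(\boldsymbol{\Lambda}+\boldsymbol{\Gamma})\mathbf{V}_{\mathbf{R}}^T$ where $\boldsymbol{\Gamma}$ is the diagonal matrix with $\boldsymbol{\Gamma}(k,k)=\max\{T-\lambda_k,0\}$, and let $J_{ME}$ be the function obtained from $J$ by replacing $\mathbf{R}$ with $\mathbf{R}_{ME}$. Then for all $\mathbf{x}\in\mathbb{R}^n$, $$J_{ME}(\mathbf{x})=J(\mathbf{x})-\tfrac12(\mathbf{y}-h[\mathbf{x}])^T\mathbf{V}_{\mathbf{R}}\widetilde{\boldsymbol{\Gamma}}\mathbf{V}_{\mathbf{R}}^T(\mathbf{y}-h[\mathbf{x}]),$$ where $\widetilde{\boldsymbol{\Gamma}}$ is the diagonal matrix with $$\widetilde{\boldsymbol{\Gamma}}(i,i)=\begin{cases}0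 & \text{if }\lambda_i\ge T,\\ \dfrac{T-\lambda_i}{T\lambda_i} & \text{if }\lambda_i<T.\end{cases}$$
   Context: $\lambda_1\ge\dots\ge\lambda_d>0$ are the eigenvalues of $\mathbf{R}$, and $\mathbf{R}=\mathbf{V}_{\mathbf{R}}\boldsymbol{\Lambda}\mathbf{V}_{\mathbf{R}}^T$ is an eigendecomposition with $\boldsymbol{\Lambda}=\operatorname{Diag}(\lambda_1,\dots,\lambda_d)$ and $\mathbf{V}_{\mathbf{R}}\in\mathbb{R}^{d\times d}$ a corresponding matrix of orthonormal eigenvectors. $\kappa(\mathbf{R})=\lambda_1/\lambda_d$ is the condition number. $J$ is the 3D-Var data assimilation objective function, with background $\mathbf{x}_b$, observations $\mathbf{y}$, observation operator $h$, background error covariance $\mathbf{B}$ and observation error covariance $\mathbf{R}$; passing from $\mathbf{R}$ to $\mathbf{R}_{ME}$ is the minimum eigenvalue reconditioning method with target condition number $\kappa_{max}$. *)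

theory Defs
  imports "HOL-Analysis.Analysis"
begin

definition sym_pos_def :: "real^'n^'n \<Rightarrow> bool" where
  "sym_pos_def A \<longleftrightarrow> transpose A = A \<and> (\<forall>x. x \<noteq> 0 \<longrightarrow> x \<bullet> (A *v x) > 0)"

definition diag_mat :: "('d \<Rightarrow> real) \<Rightarrow> real^'d^'d" where
  "diag_mat f = (\<chi> i j. if i = j then f i else 0)"

text \<open>
  The finite linear order \<^typ>\<open>'d\<close> plays the role of the index set \<open>1 < \<dots> < d\<close>, so that the
  eigenvalues (with multiplicity) can be listed in decreasing order; the columns of \<open>V\<close> are the
  corresponding orthonormal eigenvectors.  The largest eigenvalue is \<open>lam (Min UNIV)\<close>.
\<close>

definition eigendecomposition ::
    "real^('d::{finite,linorder})^('d::{finite,linorder}) \<Rightarrow>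
     real^('d::{finite,linorder})^('d::{finite,linorder}) \<Rightarrow> ('d \<Rightarrow> real) \<Rightarrow> bool" where
  "eigendecomposition R V lam \<longleftrightarrow>
     antimono lam \<and> orthogonal_matrix V \<and> R = V ** diag_mat lam ** transpose V"

definition eigenvalues :: "real^'d^'d \<Rightarrow> real set" where
  "eigenvalues A = {\<mu>. \<exists>v. v \<noteq> 0 \<and> A *v v = \<mu> *\<^sub>R v}"

text \<open>The spectral condition number; intended for symmetric positive definite matrices only.\<close>

definition condition_number :: "real^'d^'d \<Rightarrow> real" where
  "condition_number A = Max (eigenvalues A) / Min (eigenvalues A)"

definition threeDVar_objective ::
    "real^'n^'n \<Rightarrow> real^'d^'d \<Rightarrow> real^'n \<Rightarrow> real^'d \<Rightarrow> (real^'n \<Rightarrow> real^'d) \<Rightarrow> real^'n \<Rightarrow> real" where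
  "threeDVar_objective B R xb y h x =
     1/2 * ((x - xb) \<bullet> (matrix_inv B *v (x - xb))) +
     1/2 * ((y - h x) \<bullet> (matrix_inv R *v (y - h x)))"

definition me_recondition :: "real^'d^'d \<Rightarrow> ('d \<Rightarrow> real) \<Rightarrow> real \<Rightarrow> real^'d^'d" where
  "me_recondition V lam T =
     V ** (diag_mat lam + diag_mat (\<lambda>k. max (T - lam k) 0)) ** transpose V"

end

theory Submission
  imports Defs
begin

text \<open>
  In the eigenbasis of \<open>R\<close> everything is diagonal. Inverting \<open>V ** diag_mat f ** transpose V\<close> with
  orthogonal \<open>V\<close> only inverts the diagonal entries (\<open>matrix_inv_orthogonal_diag\<close>), and
  reconditioning replaces each \<open>lam k\<close> by \<open>max (lam k) T\<close>. So the inverses of \<open>R\<close> and of its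
  reconditioned version differ by the conjugate of a diagonal matrix whose entries are
  \<open>1 / lam k - 1 / max (lam k) T\<close>: this is \<open>0\<close> if \<open>lam k \<ge> T\<close> and \<open>(T - lam k) / (T * lam k)\<close>
  otherwise. The background term is the same in both objectives, and the observation term is linear
  in the inverse of the error covariance, which gives the claim. The inversions are legitimate
  because positive definiteness makes every \<open>lam k\<close> positive (\<open>sym_pos_def_diag_pos\<close>).
\<close>

lemma diag_mat_add: "diag_mat f + diag_mat g = diag_mat (\<lambda>i. f i + g i)"
  by (simp add: diag_mat_def vec_eq_iff)

lemma diag_mat_diff: "diag_mat f - diag_mat g = diag_mat (\<lambda>i. f i - g i)"
  by (simp add: diag_mat_def vec_eq_iff)

lemma diag_mat_mult: "diag_mat f ** diag_mat g = diag_mat (\<lambda>i. f i * g i)"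
  by (simp add: diag_mat_def matrix_matrix_mult_def vec_eq_iff if_distrib[of "\<lambda>a. a * _"]
      cong: if_cong)

lemma diag_mat_one: "diag_mat (\<lambda>i. 1) = mat 1"
  by (simp add: diag_mat_def mat_def)

lemma diag_mat_mult_axis: "diag_mat f *v axis i 1 = f i *\<^sub>R axis i 1"
  by (simp add: vec_eq_iff matrix_vector_mul_component inner_axis)
    (simp add: diag_mat_def axis_def)

lemma orthogonal_conj_mult:
  fixes V A B :: "real^'d^'d"
  assumes "orthogonal_matrix V"
  shows "(V ** A ** transpose V) ** (V ** B ** transpose V) = V ** (A ** B) ** transpose V"
proof -
  have "(V ** A ** transpose V) ** (V ** B ** transpose V)
      = V ** A ** (transpose V ** V) ** B ** transpose V"
    by (simp add: matrix_mul_assoc)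
  also have "\<dots> = V ** (A ** B) ** transpose V"
    using assms by (simp add: orthogonal_matrix_def matrix_mul_assoc)
  finally show ?thesis .
qed

lemma matrix_inv_eqI:
  fixes A C :: "real^'d^'d"
  assumes "A ** C = mat 1" and "C ** A = mat 1"
  shows "matrix_inv A = C"
proof -
  have "A ** matrix_inv A = mat 1"
    unfolding matrix_inv_def by (rule someI2[of _ C]) (use assms in auto)
  then have "C ** (A ** matrix_inv A) = C"
    by simp
  then show ?thesis
    using assms(2) by (simp add: matrix_mul_assoc)
qed

lemma matrix_mult_diff_conj:
  fixes V A B W :: "real^'d^'d"
  shows "V ** (A - B) ** W = V ** A ** W - V ** B ** W"
  by (simp add: matrix_matrix_mult_def vec_eq_iff algebra_simps sum_subtractf)

lemma matrix_inv_orthogonal_diag: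
  fixes V :: "real^'d^'d"
  assumes V: "orthogonal_matrix V" and nz: "\<And>i. f i \<noteq> 0"
  shows "matrix_inv (V ** diag_mat f ** transpose V)
    = V ** diag_mat (\<lambda>i. 1 / f i) ** transpose V"
proof (rule matrix_inv_eqI)
  show "(V ** diag_mat f ** transpose V) ** (V ** diag_mat (\<lambda>i. 1 / f i) ** transpose V) = mat 1"
    using V nz
    by (simp add: orthogonal_conj_mult diag_mat_mult diag_mat_one orthogonal_matrix_def)
  show "(V ** diag_mat (\<lambda>i. 1 / f i) ** transpose V) ** (V ** diag_mat f ** transpose V) = mat 1"
    using V nz
    by (simp add: orthogonal_conj_mult diag_mat_mult diag_mat_one orthogonal_matrix_def)
qed

text \<open>
  The quadratic form of the matrix, evaluated at the \<open>i\<close>-th column of \<open>V\<close>, returns \<open>f i\<close>.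
\<close>

lemma sym_pos_def_diag_pos:
  fixes V :: "real^'d^'d"
  assumes V: "orthogonal_matrix V" and pd: "sym_pos_def (V ** diag_mat f ** transpose V)"
  shows "f i > 0"
proof -
  define v where "v = V *v axis i 1"
  have tv: "transpose V *v v = axis i 1"
    using V by (simp add: v_def matrix_vector_mul_assoc orthogonal_matrix_def)
  then have "v \<noteq> 0"
    by (metis axis_eq_0_iff matrix_vector_mult_0_right zero_neq_one)
  then have "0 < v \<bullet> ((V ** diag_mat f ** transpose V) *v v)"
    using pd by (simp add: sym_pos_def_def)
  also have "(V ** diag_mat f ** transpose V) *v v = V *v (diag_mat f *v (transpose V *v v))"
    by (simp only: matrix_vector_mul_assoc matrix_mul_assoc)
  also have "v \<bullet> \<dots> = (transpose V *v v) \<bullet> (diag_mat f *v (transpose V *v v))"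
    by (simp add: dot_lmul_matrix[symmetric])
  also have "\<dots> = f i"
    by (simp only: tv diag_mat_mult_axis) (simp add: inner_axis_axis)
  finally show ?thesis .
qed

theorem theorem7:
  fixes B :: "real^'n^'n"
    and R V :: "real^('d::{finite,linorder})^('d::{finite,linorder})"
    and lam :: "'d \<Rightarrow> real"
    and xb :: "real^'n"
    and y :: "real^('d::{finite,linorder})"
    and h :: "real^'n \<Rightarrow> real^('d::{finite,linorder})"
    and \<kappa>max T :: real
  assumes "sym_pos_def B"
    and "sym_pos_def R"
    and "eigendecomposition R V lam"
    and "1 \<le> \<kappa>max"
    and "\<kappa>max < condition_number R"
    and "T = lam (Min UNIV) / \<kappa>max"
  shows "\<forall>x. threeDVar_objective B (me_recondition V lam T) xb y h x =
    threeDVar_objective B R xb y h x -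
      1/2 * ((y - h x) \<bullet>
        ((V ** diag_mat (\<lambda>i. if lam i \<ge> T then 0 else (T - lam i) / (T * lam i)) ** transpose V)
          *v (y - h x)))"
proof -
  define \<Gamma>' where "\<Gamma>' = (\<lambda>i. if lam i \<ge> T then 0 else (T - lam i) / (T * lam i))"
  have V: "orthogonal_matrix V" and R: "R = V ** diag_mat lam ** transpose V"
    using assms(3) by (auto simp: eigendecomposition_def)
  have lam_pos: "lam i > 0" for i
    using sym_pos_def_diag_pos[OF V] assms(2) R by blast
  have R_inv: "matrix_inv R = V ** diag_mat (\<lambda>i. 1 / lam i) ** transpose V"
    unfolding R using lam_pos by (intro matrix_inv_orthogonal_diag[OF V] less_imp_neq[symmetric])
  have ME: "me_recondition V lam T = V ** diag_mat (\<lambda>i. max (lam i) T) ** transpose V"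
  proof -
    have "(\<lambda>i. lam i + max (T - lam i) 0) = (\<lambda>i. max (lam i) T)"
      by (auto simp: max_def)
    then show ?thesis
      by (simp add: me_recondition_def diag_mat_add)
  qed
  have "max (lam i) T \<noteq> 0" for i
    using lam_pos[of i] by (simp add: max_def)
  then have "matrix_inv (me_recondition V lam T)
      = V ** diag_mat (\<lambda>i. 1 / max (lam i) T) ** transpose V"
    unfolding ME by (intro matrix_inv_orthogonal_diag[OF V])
  also have "(\<lambda>i. 1 / max (lam i) T) = (\<lambda>i. 1 / lam i - \<Gamma>' i)"
  proof
    fix i
    \<comment> \<open>Division by \<open>T\<close> only happens when \<open>lam i < T\<close>, and then \<open>T > 0\<close>.\<close>
    show "1 / max (lam i) T = 1 / lam i - \<Gamma>' i"
      using lam_pos[of i] by (simp add: \<Gamma>'_def max_def field_simps)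
  qed
  also have "V ** diag_mat (\<lambda>i. 1 / lam i - \<Gamma>' i) ** transpose V
      = matrix_inv R - V ** diag_mat \<Gamma>' ** transpose V"
    by (simp add: R_inv diag_mat_diff[symmetric] matrix_mult_diff_conj)
  finally have "matrix_inv (me_recondition V lam T)
      = matrix_inv R - V ** diag_mat \<Gamma>' ** transpose V" .
  then show ?thesis
    unfolding threeDVar_objective_def \<Gamma>'_def[symmetric]
    by (simp add: matrix_vector_mult_diff_rdistrib inner_diff_right right_diff_distrib)
qed

end
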